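(* Let $\mathrm{Alg}$ be a deterministic $(\alpha,\beta,\gamma)$-competitive algorithm for $\mathrm{ASG}$ with respect to $(\mu_0,\mu_1)$. If $\alpha$ is finite, then $\beta$ is infinite.
   Context: $\mathrm{ASG}$ (the case $t=\infty$ of asymmetric string guessing with predictions): an instance is a triple $I=(x,\hat{x},r)$ with $x,\hat x\in\{0,1\}^n$ and $r=\langle r_1,\dots,r_n\rangle$; each request $r_i$ prompts the algorithm to irrevocably output a bit $y_i$, and $\hat x_i$ is revealed together with $r_i$; $x$ is revealed after the last request. Cost: $\mathrm{Alg}(I)=\sum_i y_i$ if there is no $i$ with $x_i=1$ and $y_i=0$, and $\mathrm{Alg}(I)=\infty$ otherwise; $\mathrm{Opt}(I)=\sum_i x_i$. $\mu_0(I)=\sum_i x_i(1-\hat x_i)$, $\mu_1(I)=\sum_i(1-x_i)\hat x_i$. Convention: $\infty\cdot\eta(I)=0$ whenever $\eta(I)=0$. $(\alpha,\beta,\gamma)$-competitive w.r.t. $(\mu_0,\mu_1)$: there is a constant $\kappa$ with $\mathrm{Alg}(I)\le \alpha\,\mathrm{Opt}(I)+\beta\mu_0(I)+\gamma\mu_1(I)+\kappa$ for all instances $I$. *)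

theory Defs
  imports "HOL-Library.Extended_Nonnegative_Real"
begin

text \<open>
  An instance is a triple \<open>(x, xh, r)\<close> of true bits, predicted bits and requests. Requests come from
  an arbitrary type \<open>'r\<close>; taking \<open>'r = unit\<close> gives contentless prompts.
\<close>

type_synonym 'r asg_instance = "bool list \<times> bool list \<times> 'r list"

definition asg_instances :: "'r asg_instance set" where
  "asg_instances = {(x, xh, r). length xh = length x \<and> length r = length x}"

text \<open>
  A deterministic online algorithm maps the sequence of pairs (request, prediction) revealed so far,
  including the current one, to the next output bit. It does not see \<open>x\<close>, nor the length of the
  input. Its own earlier outputs are determined by this sequence, hence are not a separate argument.
\<close>

type_synonym 'r asg_algorithm = "('r \<times> bool) list \<Rightarrow> bool"

fun asg_output :: "'r asg_algorithm \<Rightarrow> 'r asg_instance \<Rightarrow> bool list" where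
  "asg_output A (x, xh, r) = map (\<lambda>i. A (take (Suc i) (zip r xh))) [0..<length r]"

fun asg_cost :: "'r asg_algorithm \<Rightarrow> 'r asg_instance \<Rightarrow> ennreal" where
  "asg_cost A (x, xh, r) =
     (let y = asg_output A (x, xh, r) in
      if \<exists>i<length x. x ! i \<and> \<not> y ! i then \<infinity>
      else (\<Sum>i<length x. of_bool (y ! i)))"

fun asg_opt :: "'r asg_instance \<Rightarrow> nat" where
  "asg_opt (x, xh, r) = (\<Sum>i<length x. of_bool (x ! i))"

fun asg_mu0 :: "'r asg_instance \<Rightarrow> nat" where
  "asg_mu0 (x, xh, r) = (\<Sum>i<length x. of_bool (x ! i) * (1 - of_bool (xh ! i)))"

fun asg_mu1 :: "'r asg_instance \<Rightarrow> nat" where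
  "asg_mu1 (x, xh, r) = (\<Sum>i<length x. (1 - of_bool (x ! i)) * of_bool (xh ! i))"

text \<open>
  In \<^typ>\<open>ennreal\<close>, \<open>\<infinity> * 0 = 0\<close>, which is the required convention. The inequality is stated in
  \<^typ>\<open>ereal\<close> because the additive constant may be any real number.
\<close>

definition asg_competitive ::
  "'r asg_algorithm \<Rightarrow> ennreal \<Rightarrow> ennreal \<Rightarrow> ennreal \<Rightarrow> bool" where
  "asg_competitive A \<alpha> \<beta> \<gamma> \<longleftrightarrow>
     (\<exists>\<kappa>::real. \<forall>I\<in>asg_instances.
        enn2ereal (asg_cost A I) \<le>
        enn2ereal (\<alpha> * of_nat (asg_opt I) + \<beta> * of_nat (asg_mu0 I) + \<gamma> * of_nat (asg_mu1 I))
        + ereal \<kappa>)"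

end

theory Submission
  imports Defs
begin

text \<open>
  With all predictions equal to \<open>0\<close> there is no wrong prediction of value \<open>1\<close>, so \<open>\<gamma>\<close> plays no role.
  If \<open>\<alpha>\<close> and \<open>\<beta>\<close> were finite, the bound on the all-ones truth would be finite, so the algorithm
  would have to answer every such prompt with \<open>1\<close>. On the all-zeros truth of length \<open>n\<close> it then pays
  \<open>n\<close>, whereas the bound is the constant \<open>\<kappa>\<close>.
\<close>

definition zero_prediction_instance :: "nat \<Rightarrow> bool \<Rightarrow> 'r asg_instance" where
  "zero_prediction_instance n b = (replicate n b, replicate n False, replicate n undefined)"

lemma zero_prediction_instance_in_instances:
  "zero_prediction_instance n b \<in> asg_instances"
  by (simp add: zero_prediction_instance_def asg_instances_def)

text \<open>The right-hand side is free of \<open>b\<close>: the algorithm sees only requests and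
  predictions, so both truths look alike to it. As all prompts are equal (\<open>undefined\<close>
  is just some fixed request), the answer at index \<open>i\<close> does not depend on
  \<open>n\<close> either.\<close>

lemma asg_output_zero_prediction_instance:
  "asg_output A (zero_prediction_instance n b) =
     map (\<lambda>i. A (replicate (Suc i) (undefined, False))) [0..<n]"
  by (auto simp: zero_prediction_instance_def zip_replicate min_def simp del: replicate_Suc)

lemma asg_opt_zero_prediction_instance:
  "asg_opt (zero_prediction_instance n b) = (if b then n else 0)"
  by (simp add: zero_prediction_instance_def)

lemma asg_mu0_zero_prediction_instance:
  "asg_mu0 (zero_prediction_instance n b) = (if b then n else 0)"
  by (simp add: zero_prediction_instance_def)

lemma asg_mu1_zero_prediction_instance:
  "asg_mu1 (zero_prediction_instance n b) = 0"
  by (simp add: zero_prediction_instance_def)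

lemma asg_cost_all_ones:
  assumes "i < n" and "\<not> A (replicate (Suc i) (undefined, False))"
  shows "asg_cost A (zero_prediction_instance n True) = \<infinity>"
  using assms asg_output_zero_prediction_instance[of A n True]
  by (auto simp: zero_prediction_instance_def Let_def simp del: asg_output.simps replicate_Suc
      intro!: exI[of _ i])

lemma asg_cost_all_zeros:
  assumes "\<And>i. A (replicate (Suc i) (undefined, False))"
  shows "asg_cost A (zero_prediction_instance n False) = of_nat n"
  using assms asg_output_zero_prediction_instance[of A n False]
  by (simp add: zero_prediction_instance_def Let_def del: asg_output.simps replicate_Suc)

theorem theorem16:
  fixes A :: "'r asg_algorithm" and \<alpha> \<beta> \<gamma> :: ennreal
  assumes "asg_competitive A \<alpha> \<beta> \<gamma>"
    and "\<alpha> \<noteq> \<infinity>"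
  shows "\<beta> = \<infinity>"
proof (rule ccontr)
  assume \<beta>: "\<beta> \<noteq> \<infinity>"
  obtain \<kappa> :: real where \<kappa>: "\<And>I. I \<in> asg_instances \<Longrightarrow>
      enn2ereal (asg_cost A I) \<le>
      enn2ereal (\<alpha> * of_nat (asg_opt I) + \<beta> * of_nat (asg_mu0 I) + \<gamma> * of_nat (asg_mu1 I))
      + ereal \<kappa>"
    using assms(1) unfolding asg_competitive_def by blast
  \<comment> \<open>Since \<open>asg_mu1\<close> is 0 here, the \<gamma> term vanishes even for
    \<gamma> = \<infinity>, by the convention \<infinity> * 0 = 0.\<close>
  have bound: "enn2ereal (asg_cost A (zero_prediction_instance n b)) \<le>
      enn2ereal (if b then (\<alpha> + \<beta>) * of_nat n else 0) + ereal \<kappa>" for n b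
    using \<kappa>[OF zero_prediction_instance_in_instances[of n b]]
    by (simp add: asg_opt_zero_prediction_instance asg_mu0_zero_prediction_instance
        asg_mu1_zero_prediction_instance distrib_right split: if_splits)
  have ones: "A (replicate (Suc i) (undefined, False))" for i
  proof (rule ccontr)
    assume "\<not> A (replicate (Suc i) (undefined, False))"
    \<comment> \<open>Length \<open>Suc i\<close> is the least that contains index
      \<open>i\<close>.\<close>
    then have "enn2ereal \<infinity> \<le> enn2ereal ((\<alpha> + \<beta>) * of_nat (Suc i)) + ereal \<kappa>"
      using bound[of "Suc i" True] asg_cost_all_ones[of i "Suc i" A] by simp
    moreover have "(\<alpha> + \<beta>) * of_nat (Suc i) \<noteq> \<infinity>"
      using assms(2) \<beta> by (simp add: ennreal_mult_eq_top_iff del: of_nat_Suc)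
    \<comment> \<open>A real value \<open>c\<close> makes the right-hand side a real number, which
      cannot dominate \<infinity>.\<close>
    then obtain c where "c \<ge> 0" "(\<alpha> + \<beta>) * of_nat (Suc i) = ennreal c"
      by (cases "(\<alpha> + \<beta>) * of_nat (Suc i)") auto
    ultimately show False
      by simp
  qed
  \<comment> \<open>The answers are 1 at every length, so \<open>n\<close> may be chosen after
    \<kappa>.\<close>
  obtain n :: nat where "\<kappa> < n"
    using reals_Archimedean2 by blast
  moreover have "enn2ereal (of_nat n) \<le> ereal \<kappa>"
    using bound[of n False] asg_cost_all_zeros[of A n] ones
    by (simp add: zero_ennreal.rep_eq del: replicate_Suc)
  ultimately show False
    by simp
qed

end
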